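(* For integers $1\leq k\leq n-1$ with $k$ odd, let $\tau_{\mathrm{mix}}=\tau_{\mathrm{mix}}(n,k)$ be the mixing time of the generalized Rudvalis shuffle on $n$ cards with $p_{n-k}=p_n=1/2$. If $k=k(n)$ is odd and $k=o(n)$ as $n\to\infty$, then $$\tau_{\mathrm{mix}} \geq (1+o(1))\,\frac{n^3}{4\pi^2 k(k+1)}\log n .$$
   Context: Generalized Rudvalis (GR) shuffle: the state space is the set $S_n$ of orderings of a deck of $n$ cards, with positions $1$ (top) to $n$ (bottom), and each position $j$ has a fixed probability $p_j$, $\sum_j p_j=1$. At each time step, independently of the past, a position is chosen, position $j$ with probability $p_j$, and the card currently in that position is moved to the top of the deck without altering the relative order of the other cards. Here $p_{n-k}=p_n=1/2$ and all other $p_j$ are $0$. The stationary distribution is the uniform distribution on $S_n$. Mixing time: with $\|\mu-\nu\|=\frac12\sum_s|\mu(s)-\nu(s)|$ and $\nu_{\mathrm{st}}$ the stationary distribution, $\tau_{\mathrm{mix}} := \max_s\min\{t : \|P(X_t\in\cdot\mid X_0=s)-\nu_{\mathrm{st}}\|\leq 1/4\}$. $\log$ is the natural logarithm and $\pi=3.14159\ldots$ in the claim. *)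

theory Defs
  imports
    "HOL-Probability.Probability"
    "HOL-Library.Landau_Symbols"
    "HOL-Combinatorics.Multiset_Permutations"
begin

text \<open>Finite Markov chains, given by a transition kernel \<open>K\<close> (\<open>K s\<close> is the law of the state
  after one step from \<open>s\<close>).\<close>

primrec chain_law :: "('s \<Rightarrow> 's pmf) \<Rightarrow> 's \<Rightarrow> nat \<Rightarrow> 's pmf" where
  "chain_law K s 0 = return_pmf s"
| "chain_law K s (Suc t) = bind_pmf (chain_law K s t) K"

definition tv_dist :: "'s set \<Rightarrow> 's pmf \<Rightarrow> 's pmf \<Rightarrow> real" where
  "tv_dist S \<mu> \<nu> = (1/2) * (\<Sum>s\<in>S. \<bar>pmf \<mu> s - pmf \<nu> s\<bar>)"

text \<open>The values lie in \<^typ>\<open>enat\<close>, so that the minimum over the empty set is \<open>\<infinity>\<close>: a chain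
  that never comes within \<open>1/4\<close> of \<open>\<nu>\<close> has infinite mixing time. On a nonempty set
  the infimum is attained, and for finite nonempty \<open>S\<close> so is the supremum.\<close>

definition mixing_time :: "'s set \<Rightarrow> ('s \<Rightarrow> 's pmf) \<Rightarrow> 's pmf \<Rightarrow> enat" where
  "mixing_time S K \<nu> = (SUP s\<in>S. INF t\<in>{t. tv_dist S (chain_law K s t) \<nu> \<le> 1/4}. enat t)"

text \<open>An ordering of the deck lists the cards \<open>1, \<dots>, n\<close> from top to bottom. Positions are
  counted from 1, so position \<open>j\<close> is list index \<open>j - 1\<close>.\<close>

definition decks :: "nat \<Rightarrow> nat list set" where
  "decks n = permutations_of_set {1..n}"

definition move_to_top :: "nat \<Rightarrow> 'a list \<Rightarrow> 'a list" where
  "move_to_top j xs = xs ! (j - 1) # take (j - 1) xs @ drop j xs"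

definition gr_kernel :: "nat pmf \<Rightarrow> 'a list \<Rightarrow> 'a list pmf" where
  "gr_kernel p xs = map_pmf (\<lambda>j. move_to_top j xs) p"

text \<open>The shuffle with \<open>p\<^sub>n\<^sub>-\<^sub>k = p\<^sub>n = 1/2\<close>; meaningful for \<open>1 \<le> k \<le> n - 1\<close>, when
  \<open>n - k\<close> and \<open>n\<close> are distinct positions.\<close>

definition gr_mixing_time :: "nat \<Rightarrow> nat \<Rightarrow> enat" where
  "gr_mixing_time n k =
     mixing_time (decks n) (gr_kernel (pmf_of_set {n - k, n})) (pmf_of_set (decks n))"

end

theory Submission imports Defs begin

text \<open>
  The proof is Wilson's lower bound, run with a statistic that is linear in the positions of the cards.

  A single card performs a Markov chain on the positions: it descends one step at a time to position
  \<open>n - k\<close>, from where it jumps to the top with probability \<open>1/2\<close>; otherwise it crosses the last \<open>k\<close>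
  positions, waiting at each for a geometric time with mean 2, before it returns to the top. A circuit
  thus takes time \<open>n\<close> on average, with variance \<open>k * (k + 1)\<close>. The phase of a card therefore rotates by
  \<open>2 * pi\<close> per circuit while it diffuses slowly, and the corresponding eigenvalue \<open>\<theta>\<close> satisfies
  \<open>- ln (cmod \<theta>) = (1 + o(1)) * 2 * pi\<^sup>2 * k * (k + 1) / n ^ 3\<close>. The explicit eigenfunction is
  \<open>position_eigenfunction\<close>, and the eigenvalue is located in \<open>characteristic_root\<close>; an
  exact solution is used there, because an approximate eigenfunction would accumulate errors over the roughly
  \<open>n ^ 3\<close> steps considered.

  Adding up the eigenfunction over all cards, with weights that align the phases in the initial deck,
  gives an eigenfunction \<open>\<Phi>\<close> of the shuffle with initial value of order \<open>n\<close>. In one step the two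
  possible moves differ only in what happens to the last \<open>k + 1\<close> cards, and the two values of \<open>\<Phi>\<close>
  differ by a quantity of order \<open>k / n\<close>. Hence the variance of \<open>\<Phi>\<close> in equilibrium, and at
  any time, is at most of order \<open>(k / n)\<^sup>2 / (1 - (cmod \<theta>)\<^sup>2)\<close>, that is of order \<open>n\<close>. The mean of
  \<open>\<Phi>\<close> after \<open>t\<close> steps has modulus of order \<open>n * (cmod \<theta>) ^ t\<close>, and it stays above the standard
  deviation until \<open>t\<close> is about \<open>ln n / (- 2 * ln (cmod \<theta>))\<close>; up to this time the law of the deck
  is far from uniform (\<open>wilson_lower_bound\<close>). This time is the one claimed.
\<close>

section \<open>Wilson's lower bound for an eigenfunction of a finite chain\<close>

text \<open>
  Bias--variance decomposition: the mean minimises the mean square distance, because the cross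
  term has expectation zero.
\<close>

lemma expectation_norm_diff_sq:
  fixes \<Phi> :: "'s \<Rightarrow> complex"
  assumes "finite (set_pmf p)"
  shows "measure_pmf.expectation p (\<lambda>x. (cmod (\<Phi> x - b))\<^sup>2) =
    measure_pmf.expectation p (\<lambda>x. (cmod (\<Phi> x - measure_pmf.expectation p \<Phi>))\<^sup>2) +
    (cmod (measure_pmf.expectation p \<Phi> - b))\<^sup>2"
proof -
  define m where "m = measure_pmf.expectation p \<Phi>"
  have int: "integrable (measure_pmf p) h" for h :: "'s \<Rightarrow> 'x :: {banach, second_countable_topology}"
    using assms by (rule integrable_measure_pmf_finite)
  have expand: "(cmod (z - b))\<^sup>2 = (cmod (z - m))\<^sup>2 + (cmod (m - b))\<^sup>2 + 2 * Re ((z - m) * cnj (m - b))" for z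
    unfolding cmod_power2 by (simp add: power2_eq_square algebra_simps)
  have "measure_pmf.expectation p (\<lambda>x. Re ((\<Phi> x - m) * cnj (m - b)))
      = Re (measure_pmf.expectation p (\<lambda>x. (\<Phi> x - m) * cnj (m - b)))"
    by (rule integral_Re[OF int])
  also have "\<dots> = 0"
    by (simp add: m_def int)
  finally have cross: "measure_pmf.expectation p (\<lambda>x. Re ((\<Phi> x - m) * cnj (m - b))) = 0" .
  have "measure_pmf.expectation p (\<lambda>x. (cmod (\<Phi> x - b))\<^sup>2) = 
     measure_pmf.expectation p (\<lambda>x. (cmod (\<Phi> x - m))\<^sup>2) + (cmod (m - b))\<^sup>2"
    by (subst expand) (simp add: int cross del: times_complex.sel complex_cnj_diff)
  then show ?thesis by (simp add: m_def)
qed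

text \<open>
  One step of the chain multiplies an eigenfunction by its eigenvalue \<open>\<theta>\<close> and adds fresh noise,
  orthogonal to the past, of variance at most \<open>R\<close>. The centre \<open>c\<close> is free so that the same
  recursion serves a run from a fixed state (\<open>c\<close> the current mean) and the stationary law (\<open>c = 0\<close>).
\<close>

lemma second_moment_step:
  fixes \<Phi> :: "'s \<Rightarrow> complex"
  assumes S: "finite S" "set_pmf \<mu> \<subseteq> S" "\<And>s. s \<in> S \<Longrightarrow> set_pmf (K s) \<subseteq> S"
    and eig: "\<And>s. s \<in> S \<Longrightarrow> measure_pmf.expectation (K s) \<Phi> = \<theta> * \<Phi> s"
    and R: "\<And>s. s \<in> S \<Longrightarrow> measure_pmf.expectation (K s) (\<lambda>x. (cmod (\<Phi> x - \<theta> * \<Phi> s))\<^sup>2) \<le> R"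
  shows "measure_pmf.expectation (bind_pmf \<mu> K) (\<lambda>x. (cmod (\<Phi> x - \<theta> * c))\<^sup>2)
    \<le> (cmod \<theta>)\<^sup>2 * measure_pmf.expectation \<mu> (\<lambda>x. (cmod (\<Phi> x - c))\<^sup>2) + R"
proof -
  have fK: "finite (set_pmf (K s))" if "s \<in> S" for s
    using S(1) S(3)[OF that] finite_subset by blast
  have one: "measure_pmf.expectation (K s) (\<lambda>x. (cmod (\<Phi> x - \<theta> * c))\<^sup>2)
      \<le> R + (cmod \<theta>)\<^sup>2 * (cmod (\<Phi> s - c))\<^sup>2" if "s \<in> S" for s
  proof -
    have "(cmod (\<theta> * \<Phi> s - \<theta> * c))\<^sup>2 = (cmod \<theta>)\<^sup>2 * (cmod (\<Phi> s - c))\<^sup>2"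
      by (simp add: norm_mult power_mult_distrib flip: right_diff_distrib)
    then show ?thesis
      using expectation_norm_diff_sq[OF fK[OF that], of \<Phi> "\<theta> * c"] R[OF that] eig[OF that] by simp
  qed
  have tot: "(\<Sum>s\<in>S. pmf \<mu> s) = 1"
    using S(1,2) by (rule sum_pmf_eq_1)
  have "measure_pmf.expectation (bind_pmf \<mu> K) (\<lambda>x. (cmod (\<Phi> x - \<theta> * c))\<^sup>2) =
     (\<Sum>s\<in>S. pmf \<mu> s *\<^sub>R measure_pmf.expectation (K s) (\<lambda>x. (cmod (\<Phi> x - \<theta> * c))\<^sup>2))"
    using S fK by (intro pmf_expectation_bind) auto
  also have "\<dots> \<le> (\<Sum>s\<in>S. pmf \<mu> s *\<^sub>R (R + (cmod \<theta>)\<^sup>2 * (cmod (\<Phi> s - c))\<^sup>2))"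
    by (intro sum_mono scaleR_left_mono one) auto
  also have "\<dots> = (\<Sum>s\<in>S. pmf \<mu> s) * R + (cmod \<theta>)\<^sup>2 * (\<Sum>s\<in>S. (cmod (\<Phi> s - c))\<^sup>2 * pmf \<mu> s)"
    by (simp add: sum_distrib_left sum_distrib_right sum.distrib algebra_simps)
  also have "(\<Sum>s\<in>S. (cmod (\<Phi> s - c))\<^sup>2 * pmf \<mu> s) = measure_pmf.expectation \<mu> (\<lambda>x. (cmod (\<Phi> x - c))\<^sup>2)"
    using S by (intro integral_measure_pmf_real[symmetric]) auto
  finally show ?thesis using tot by simp
qed

text \<open>
  Chebyshev's inequality for two laws at once. The mass \<open>1 - tv_dist S \<mu> \<nu>\<close> is shared by \<open>\<mu>\<close> and
  \<open>\<nu>\<close>; on the shared mass \<open>\<Phi>\<close> would have to be close both to \<open>m\<close> and to \<open>0\<close>, which costs at least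
  \<open>(cmod m)\<^sup>2 / 2\<close> in the sum of the two second moments.
\<close>

lemma overlap_le_second_moments:
  fixes \<Phi> :: "'s \<Rightarrow> complex"
  assumes S: "finite S" "set_pmf \<mu> \<subseteq> S" "set_pmf \<nu> \<subseteq> S"
  shows "(1 - tv_dist S \<mu> \<nu>) * (cmod m)\<^sup>2 \<le>
    2 * measure_pmf.expectation \<mu> (\<lambda>x. (cmod (\<Phi> x - m))\<^sup>2) + 2 * measure_pmf.expectation \<nu> (\<lambda>x. (cmod (\<Phi> x))\<^sup>2)"
proof -
  have tot: "(\<Sum>s\<in>S. pmf \<mu> s) = 1" "(\<Sum>s\<in>S. pmf \<nu> s) = 1"
    using S by (auto intro: sum_pmf_eq_1)
  have min_eq: "min (pmf \<mu> s) (pmf \<nu> s) = (pmf \<mu> s + pmf \<nu> s - \<bar>pmf \<mu> s - pmf \<nu> s\<bar>) / 2" for s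
    by (auto simp: min_def abs_if)
  have ov: "1 - tv_dist S \<mu> \<nu> = (\<Sum>s\<in>S. min (pmf \<mu> s) (pmf \<nu> s))"
    unfolding min_eq tv_dist_def using tot
    by (simp add: sum.distrib sum_subtractf flip: sum_divide_distrib)
  have "(1 - tv_dist S \<mu> \<nu>) * (cmod m)\<^sup>2 = (\<Sum>s\<in>S. min (pmf \<mu> s) (pmf \<nu> s) * (cmod m)\<^sup>2)"
    by (simp add: ov sum_distrib_right)
  also have "\<dots> \<le> (\<Sum>s\<in>S. 2 * ((cmod (\<Phi> s - m))\<^sup>2 * pmf \<mu> s) + 2 * ((cmod (\<Phi> s))\<^sup>2 * pmf \<nu> s))"
  proof (rule sum_mono)
    fix s
    let ?q = "min (pmf \<mu> s) (pmf \<nu> s)"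
    have "cmod m \<le> cmod (\<Phi> s - m) + cmod (\<Phi> s)"
      using norm_triangle_ineq4[of "\<Phi> s" "\<Phi> s - m"] by simp
    then have "(cmod m)\<^sup>2 \<le> (cmod (\<Phi> s - m) + cmod (\<Phi> s))\<^sup>2"
      by (intro power_mono) auto
    also have "\<dots> \<le> 2 * (cmod (\<Phi> s - m))\<^sup>2 + 2 * (cmod (\<Phi> s))\<^sup>2"
      using sum_squares_bound[of "cmod (\<Phi> s - m)" "cmod (\<Phi> s)"] by (simp add: power2_sum)
    finally have "?q * (cmod m)\<^sup>2 \<le> ?q * (2 * (cmod (\<Phi> s - m))\<^sup>2 + 2 * (cmod (\<Phi> s))\<^sup>2)"
      by (intro mult_left_mono) auto
    also have "\<dots> = 2 * ((cmod (\<Phi> s - m))\<^sup>2 * ?q) + 2 * ((cmod (\<Phi> s))\<^sup>2 * ?q)"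
      by (simp add: algebra_simps)
    also have "\<dots> \<le> 2 * ((cmod (\<Phi> s - m))\<^sup>2 * pmf \<mu> s) + 2 * ((cmod (\<Phi> s))\<^sup>2 * pmf \<nu> s)"
      by (intro add_mono mult_left_mono) auto
    finally show "?q * (cmod m)\<^sup>2 \<le> 2 * ((cmod (\<Phi> s - m))\<^sup>2 * pmf \<mu> s) + 2 * ((cmod (\<Phi> s))\<^sup>2 * pmf \<nu> s)" .
  qed
  also have "\<dots> = 2 * (\<Sum>s\<in>S. (cmod (\<Phi> s - m))\<^sup>2 * pmf \<mu> s) + 2 * (\<Sum>s\<in>S. (cmod (\<Phi> s))\<^sup>2 * pmf \<nu> s)"
    by (simp add: sum.distrib sum_distrib_left)
  also have "(\<Sum>s\<in>S. (cmod (\<Phi> s - m))\<^sup>2 * pmf \<mu> s) = measure_pmf.expectation \<mu> (\<lambda>x. (cmod (\<Phi> x - m))\<^sup>2)"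
    using S by (intro integral_measure_pmf_real[symmetric]) auto
  also have "(\<Sum>s\<in>S. (cmod (\<Phi> s))\<^sup>2 * pmf \<nu> s) = measure_pmf.expectation \<nu> (\<lambda>x. (cmod (\<Phi> x))\<^sup>2)"
    using S by (intro integral_measure_pmf_real[symmetric]) auto
  finally show ?thesis .
qed

text \<open>
  The fixed point \<open>R / (1 - (cmod \<theta>)\<^sup>2)\<close> of the recursion for second moments bounds the variance of
  \<open>\<Phi>\<close> at every time. It also bounds the second moment under \<open>\<nu>\<close>, as one step of the recursion with
  \<open>c = 0\<close> leaves the law \<open>\<nu>\<close> unchanged. As long as the mean \<open>\<theta> ^ t * \<Phi> x\<close> exceeds a
  fixed multiple of the resulting standard deviation, the two laws can be told apart.
\<close>

lemma wilson_lower_bound: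
  fixes \<Phi> :: "'s \<Rightarrow> complex"
  assumes S: "finite S" "\<And>s. s \<in> S \<Longrightarrow> set_pmf (K s) \<subseteq> S"
    and eig: "\<And>s. s \<in> S \<Longrightarrow> measure_pmf.expectation (K s) \<Phi> = \<theta> * \<Phi> s"
    and R: "\<And>s. s \<in> S \<Longrightarrow> measure_pmf.expectation (K s) (\<lambda>x. (cmod (\<Phi> x - \<theta> * \<Phi> s))\<^sup>2) \<le> R"
    and stat: "set_pmf \<nu> \<subseteq> S" "bind_pmf \<nu> K = \<nu>"
    and contr: "cmod \<theta> < 1" and x: "x \<in> S"
    and close: "tv_dist S (chain_law K x t) \<nu> \<le> 1/4"
  shows "3/4 * (cmod (\<theta> ^ t * \<Phi> x))\<^sup>2 \<le> 4 * (R / (1 - (cmod \<theta>)\<^sup>2))"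
proof -
  define V where "V = R / (1 - (cmod \<theta>)\<^sup>2)"
  have gap: "1 - (cmod \<theta>)\<^sup>2 > 0"
    using contr by (simp add: power_less_one_iff abs_square_less_1)
  have V_step: "(cmod \<theta>)\<^sup>2 * V + R = V"
    using gap unfolding V_def by (simp add: field_simps)
  have "0 \<le> measure_pmf.expectation (K x) (\<lambda>y. (cmod (\<Phi> y - \<theta> * \<Phi> x))\<^sup>2)"
    by (rule integral_nonneg_AE) auto
  then have "R \<ge> 0"
    using R[OF x] by (rule order_trans)
  then have V_nonneg: "V \<ge> 0"
    using gap unfolding V_def by (intro divide_nonneg_pos) auto
  have law: "set_pmf (chain_law K x t) \<subseteq> S \<and>
     measure_pmf.expectation (chain_law K x t) (\<lambda>y. (cmod (\<Phi> y - \<theta> ^ t * \<Phi> x))\<^sup>2) \<le> V" for t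
  proof (induction t)
    case 0
    then show ?case using x V_nonneg by simp
  next
    case (Suc t)
    have "measure_pmf.expectation (chain_law K x (Suc t)) (\<lambda>y. (cmod (\<Phi> y - \<theta> ^ Suc t * \<Phi> x))\<^sup>2)
      \<le> (cmod \<theta>)\<^sup>2 * measure_pmf.expectation (chain_law K x t) (\<lambda>y. (cmod (\<Phi> y - \<theta> ^ t * \<Phi> x))\<^sup>2) + R"
      using second_moment_step[OF S(1) _ S(2) eig R, of "chain_law K x t" "\<theta> ^ t * \<Phi> x"] conjunct1[OF Suc]
      by (simp only: chain_law.simps power_Suc mult.assoc)
    also have "\<dots> \<le> (cmod \<theta>)\<^sup>2 * V + R"
      using Suc by (intro add_right_mono mult_left_mono) auto
    finally have "measure_pmf.expectation (chain_law K x (Suc t)) (\<lambda>y. (cmod (\<Phi> y - \<theta> ^ Suc t * \<Phi> x))\<^sup>2) \<le> V"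
      by (simp only: V_step)
    moreover have "set_pmf (chain_law K x (Suc t)) \<subseteq> S"
      using Suc S(2) by auto
    ultimately show ?case by blast
  qed
  have "measure_pmf.expectation \<nu> (\<lambda>y. (cmod (\<Phi> y))\<^sup>2)
     \<le> (cmod \<theta>)\<^sup>2 * measure_pmf.expectation \<nu> (\<lambda>y. (cmod (\<Phi> y))\<^sup>2) + R"
    using second_moment_step[OF S(1) stat(1) S(2) eig R, of 0] stat(2) by simp
  then have st: "measure_pmf.expectation \<nu> (\<lambda>y. (cmod (\<Phi> y))\<^sup>2) \<le> V"
    using gap unfolding V_def by (simp add: field_simps)
  have "3/4 * (cmod (\<theta> ^ t * \<Phi> x))\<^sup>2 \<le> (1 - tv_dist S (chain_law K x t) \<nu>) * (cmod (\<theta> ^ t * \<Phi> x))\<^sup>2"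
    using close by (intro mult_right_mono) auto
  also have "\<dots> \<le> 2 * V + 2 * V"
    using overlap_le_second_moments[OF S(1) conjunct1[OF law] stat(1), of t "\<theta> ^ t * \<Phi> x" \<Phi>]
      conjunct2[OF law, of t] st by linarith
  finally show ?thesis by (simp add: V_def)
qed

section \<open>The motion of a single card and linear statistics of the deck\<close>

text \<open>
  The card at list index \<open>i\<close> is at index \<open>new_index j i\<close> after \<open>move_to_top j\<close>. Indices are
  counted from 0 and positions from 1.
\<close>

definition new_index :: "nat \<Rightarrow> nat \<Rightarrow> nat" where
  "new_index j i = (if i < j - 1 then i + 1 else if i = j - 1 then 0 else i)"

definition linear_statistic :: "nat \<Rightarrow> ('a \<Rightarrow> complex) \<Rightarrow> (nat \<Rightarrow> complex) \<Rightarrow> 'a list \<Rightarrow> complex" where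
  "linear_statistic n g f xs = (\<Sum>i<n. g (xs ! i) * f i)"

text \<open>
  An eigenfunction for the motion of a single card. A card above position \<open>n - k\<close> descends one
  step at a time, which forces powers of the eigenvalue \<open>\<theta>\<close>. A card below position \<open>n - k\<close>
  stays or descends with probability \<open>1/2\<close> each, which forces powers of a number \<open>u\<close> with
  \<open>2 * \<theta> * u = u + 1\<close>; the exponent counts the steps left until the card returns to the top,
  where the value is 1. The remaining equation, at position \<open>n - k\<close>, is
  \<open>2 * \<theta> ^ (n - k) = 1 + u ^ k\<close>.
\<close>

definition position_eigenfunction :: "nat \<Rightarrow> nat \<Rightarrow> complex \<Rightarrow> complex \<Rightarrow> nat \<Rightarrow> complex" where
  "position_eigenfunction n k \<theta> u i = (if i < n - k then \<theta> ^ i else u ^ (n - i))"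

lemma nth_move_to_top:
  assumes "1 \<le> j" "j \<le> length xs" "i < length xs"
  shows "move_to_top j xs ! new_index j i = xs ! i"
proof -
  consider "i < j - 1" | "i = j - 1" | "i \<ge> j" by linarith
  then show ?thesis
  proof cases
    case 3
    then obtain d where d: "i = j + d" using le_Suc_ex by blast
    with assms show ?thesis
      by (cases j) (simp_all add: move_to_top_def new_index_def nth_append)
  qed (use assms in \<open>simp_all add: move_to_top_def new_index_def nth_append\<close>)
qed

lemma bij_betw_new_index:
  assumes "1 \<le> j" "j \<le> n"
  shows "bij_betw (new_index j) {..<n} {..<n}"
proof -
  have "inj_on (new_index j) {..<n}"
    by (auto simp: inj_on_def new_index_def split: if_splits)
  moreover have "new_index j ` {..<n} \<subseteq> {..<n}"
    using assms by (auto simp: new_index_def)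
  ultimately show ?thesis
    by (simp add: bij_betw_def endo_inj_surj)
qed

text \<open>
  Summing over the cards instead of the positions: moving the cards amounts to composing \<open>f\<close> with
  \<open>new_index j\<close>.
\<close>

lemma linear_statistic_move_to_top:
  assumes "1 \<le> j" "j \<le> n" "length xs = n"
  shows "linear_statistic n g f (move_to_top j xs) = (\<Sum>i<n. g (xs ! i) * f (new_index j i))"
proof -
  let ?ys = "move_to_top j xs"
  have "linear_statistic n g f ?ys = (\<Sum>i<n. g (?ys ! new_index j i) * f (new_index j i))"
    unfolding linear_statistic_def
    by (rule sum.reindex_bij_betw[OF bij_betw_new_index[OF assms(1,2)], symmetric])
  also have "\<dots> = (\<Sum>i<n. g (xs ! i) * f (new_index j i))"
    using assms by (intro sum.cong) (simp_all add: nth_move_to_top)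
  finally show ?thesis .
qed

lemma decks_mem_iff: "xs \<in> decks n \<longleftrightarrow> set xs = {1..n} \<and> distinct xs"
  by (auto simp: decks_def permutations_of_set_def)

lemma length_deck: "xs \<in> decks n \<Longrightarrow> length xs = n"
  using distinct_card[of xs] by (auto simp: decks_mem_iff)

lemma finite_decks: "finite (decks n)" and decks_nonempty: "decks n \<noteq> {}"
  by (auto simp: decks_def)

lemma bij_betw_move_to_top:
  assumes j: "1 \<le> j" "j \<le> n"
  shows "bij_betw (move_to_top j) (decks n) (decks n)"
proof -
  have "inj_on (move_to_top j) (decks n)"
  proof (rule inj_onI)
    fix xs ys assume xy: "xs \<in> decks n" "ys \<in> decks n" "move_to_top j xs = move_to_top j ys"
    then have len: "length xs = n" "length ys = n" by (auto simp: length_deck)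
    show "xs = ys"
    proof (rule nth_equalityI)
      fix i assume "i < length xs"
      then show "xs ! i = ys ! i"
        using nth_move_to_top[of j xs i] nth_move_to_top[of j ys i] j len xy(3) by simp
    qed (simp add: len)
  qed
  moreover have "move_to_top j ` decks n \<subseteq> decks n"
  proof
    fix ys assume "ys \<in> move_to_top j ` decks n"
    then obtain xs where xs: "xs \<in> decks n" and ys: "ys = move_to_top j xs" by auto
    have "xs = take (j - 1) xs @ xs ! (j - 1) # drop j xs"
      using id_take_nth_drop[of "j - 1" xs] j length_deck[OF xs] by simp
    then have "mset xs = mset (take (j - 1) xs @ xs ! (j - 1) # drop j xs)" by (rule arg_cong)
    then have m: "mset ys = mset xs"
      by (simp add: ys move_to_top_def)
    then show "ys \<in> decks n"
      using xs mset_eq_setD[OF m] mset_eq_imp_distinct_iff[OF m] by (simp add: decks_mem_iff)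
  qed
  ultimately show ?thesis
    by (simp add: bij_betw_def endo_inj_surj finite_decks)
qed

lemma set_gr_kernel:
  assumes "finite J" "J \<noteq> {}" "J \<subseteq> {1..n}" "xs \<in> decks n"
  shows "set_pmf (gr_kernel (pmf_of_set J) xs) \<subseteq> decks n"
proof
  fix ys assume "ys \<in> set_pmf (gr_kernel (pmf_of_set J) xs)"
  then obtain j where "j \<in> J" "ys = move_to_top j xs"
    using assms(1,2) by (auto simp: gr_kernel_def)
  then show "ys \<in> decks n"
    using bij_betw_apply[OF bij_betw_move_to_top[of j n] assms(4)] assms(3) by auto
qed

text \<open>
  Each \<open>move_to_top j\<close> permutes the decks, so a random choice of \<open>j\<close> preserves the uniform law.
\<close>

lemma uniform_stationary:
  assumes "set_pmf p \<subseteq> {1..n}"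
  shows "bind_pmf (pmf_of_set (decks n)) (gr_kernel p) = pmf_of_set (decks n)"
proof -
  have "bind_pmf (pmf_of_set (decks n)) (gr_kernel p)
     = bind_pmf p (\<lambda>j. map_pmf (move_to_top j) (pmf_of_set (decks n)))"
    unfolding gr_kernel_def map_pmf_def by (rule bind_commute_pmf)
  also have "\<dots> = bind_pmf p (\<lambda>j. pmf_of_set (decks n))"
    using assms by (intro bind_pmf_cong refl map_pmf_of_set_bij_betw bij_betw_move_to_top
        decks_nonempty finite_decks) auto
  finally show ?thesis by simp
qed

lemma expectation_gr_kernel_two:
  fixes h :: "'a list \<Rightarrow> 'b :: {banach, second_countable_topology}"
  assumes "i \<noteq> j"
  shows "measure_pmf.expectation (gr_kernel (pmf_of_set {i, j}) xs) h
    = (1/2) *\<^sub>R (h (move_to_top i xs) + h (move_to_top j xs))"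
  using assms unfolding gr_kernel_def
  by (subst integral_map_pmf, subst integral_measure_pmf[of "{i, j}"]) (auto simp: scaleR_add_right)

text \<open>
  The values of the eigenfunction before a step and after each of the two moves, with \<open>n - k = Suc m\<close>.
  In the last one, the bottom card (\<open>Suc j = k\<close>) goes to the top, where the value \<open>1 = u ^ 0\<close>
  fits the general formula.
\<close>

lemma position_eigenfunction_new_index:
  fixes \<theta> u :: complex and m k :: nat
  defines "f \<equiv> position_eigenfunction (Suc (m + k)) k \<theta> u"
  shows "i \<le> m \<Longrightarrow> f i = \<theta> ^ i"
    and "i < m \<Longrightarrow> f (new_index (Suc m) i) = \<theta> ^ Suc i"
    and "i < m \<Longrightarrow> f (new_index (Suc (m + k)) i) = \<theta> ^ Suc i"
    and "f (new_index (Suc m) m) = 1"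
    and "f (new_index (Suc (m + k)) m) = u ^ k"
    and "f (Suc m + j) = u ^ (k - j)"
    and "f (new_index (Suc m) (Suc m + j)) = u ^ (k - j)"
    and "j < k \<Longrightarrow> f (new_index (Suc (m + k)) (Suc m + j)) = u ^ (k - Suc j)"
proof -
  have f: "f i = (if i \<le> m then \<theta> ^ i else u ^ (Suc (m + k) - i))" for i
    by (simp add: f_def position_eigenfunction_def less_Suc_eq_le)
  show "i \<le> m \<Longrightarrow> f i = \<theta> ^ i"
    and "i < m \<Longrightarrow> f (new_index (Suc m) i) = \<theta> ^ Suc i"
    and "i < m \<Longrightarrow> f (new_index (Suc (m + k)) i) = \<theta> ^ Suc i"
    and "f (new_index (Suc m) m) = 1"
    and "f (Suc m + j) = u ^ (k - j)"
    and "f (new_index (Suc m) (Suc m + j)) = u ^ (k - j)"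
    by (simp_all add: f new_index_def)
  show "f (new_index (Suc (m + k)) m) = u ^ k"
    by (cases "k = 0") (simp_all add: f new_index_def)
  show "f (new_index (Suc (m + k)) (Suc m + j)) = u ^ (k - Suc j)" if "j < k"
  proof (cases "Suc j = k")
    case True
    then show ?thesis by (auto simp: f new_index_def)
  next
    case False
    with that have "Suc m + j < m + k" by simp
    then show ?thesis by (simp add: f new_index_def)
  qed
qed

lemma position_eigenfunction_average:
  assumes n: "k < n" "i < n"
    and root: "2 * \<theta> * u = u + 1" "2 * \<theta> ^ (n - k) = 1 + u ^ k"
  defines "f \<equiv> position_eigenfunction n k \<theta> u"
  shows "f (new_index (n - k) i) + f (new_index n i) = 2 * \<theta> * f i"
proof -
  define m where "m = n - k - 1"
  have nm: "n = Suc (m + k)" "n - k = Suc m" using n by (simp_all add: m_def)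
  note vals = position_eigenfunction_new_index[where m = m and k = k and \<theta> = \<theta> and u = u, folded nm, folded f_def]
  consider "i < m" | "i = m" | j where "i = Suc m + j" "j < k"
  proof (cases "i \<le> m")
    case False
    then obtain j where "i = Suc m + j" using le_Suc_ex[of "Suc m" i] by auto
    then show ?thesis using that(3) n nm by simp
  qed (use that in force)
  then show ?thesis
  proof cases
    case 1
    then show ?thesis using vals(1-3)[of i] by (simp add: nm(2))
  next
    case 2
    have "2 * \<theta> * \<theta> ^ m = 1 + u ^ k" using root(2) by (simp add: nm(2) mult.assoc)
    then show ?thesis using vals(1)[of m] vals(4,5) by (simp add: nm(2) 2)
  next
    case 3
    have "u ^ (k - j) = u * u ^ (k - Suc j)"
      using 3(2) by (metis Suc_diff_Suc power_Suc)
    moreover have "(u + 1) * u ^ (k - Suc j) = 2 * \<theta> * u * u ^ (k - Suc j)" using root(1) by simp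
    ultimately have "u ^ (k - j) + u ^ (k - Suc j) = 2 * \<theta> * u ^ (k - j)"
      by (simp add: algebra_simps)
    then show ?thesis
      unfolding 3(1) nm(2)[symmetric] vals(6,7)[of j] vals(8)[OF 3(2)] .
  qed
qed

text \<open>
  The two moves treat the cards above position \<open>n - k\<close> alike. Only \<open>k + 1\<close> cards feel the
  difference: \<open>k\<close> of them by one factor of \<open>u\<close>, and the card at position \<open>n - k\<close> by
  \<open>1 - u ^ k\<close>, which telescopes into \<open>k\<close> such steps. This makes the noise of one step small.
\<close>

lemma position_eigenfunction_discrepancy:
  fixes \<theta> u :: complex
  assumes n: "k < n" and E: "\<And>j. j < k \<Longrightarrow> cmod (u ^ j - u ^ Suc j) \<le> E"
  defines "f \<equiv> position_eigenfunction n k \<theta> u"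
  shows "(\<Sum>i<n. cmod (f (new_index (n - k) i) - f (new_index n i))) \<le> 2 * real k * E"
proof -
  define h where "h = (\<lambda>i. cmod (f (new_index (n - k) i) - f (new_index n i)))"
  define m where "m = n - k - 1"
  have nm: "n = Suc (m + k)" "n - k = Suc m" using n by (simp_all add: m_def)
  note vals = position_eigenfunction_new_index[where m = m and k = k and \<theta> = \<theta> and u = u, folded nm, folded f_def]
  have split: "sum h {..<a + b} = sum h {..<a} + (\<Sum>j<b. h (a + j))" for a b
    by (induction b) (auto simp: add_ac)
  have z: "h i = 0" if "i < m" for i
    using vals(2,3)[OF that] by (simp add: h_def nm(2))
  have tele: "1 - u ^ b = (\<Sum>j<b. u ^ j - u ^ Suc j)" for b
    using sum_lessThan_telescope'[of "\<lambda>j. u ^ j" b] by simp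
  have "h m = cmod (1 - u ^ k)"
    using vals(4,5) by (simp add: h_def nm(2))
  also have "\<dots> \<le> (\<Sum>j<k. cmod (u ^ j - u ^ Suc j))" unfolding tele by (rule norm_sum)
  also have "\<dots> \<le> (\<Sum>j<k. E)" by (intro sum_mono E) auto
  finally have hm: "h m \<le> real k * E" by simp
  have hj: "h (Suc m + j) \<le> E" if "j < k" for j
  proof -
    have e: "k - j = Suc (k - Suc j)" using that by simp
    have "h (Suc m + j) = cmod (u ^ Suc (k - Suc j) - u ^ (k - Suc j))"
      using vals(7)[of j] vals(8)[OF that] unfolding h_def nm(2) e by simp
    then show ?thesis using E[of "k - Suc j"] that by (simp add: norm_minus_commute)
  qed
  have "sum h {..<n} = sum h {..<Suc m + k}" using nm(1) by simp
  also have "\<dots> = sum h {..<m} + h m + (\<Sum>j<k. h (Suc m + j))"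
    unfolding split by simp
  also have "\<dots> \<le> 0 + real k * E + (\<Sum>j<k. E)"
    using z hm hj by (intro add_mono sum_mono) auto
  also have "\<dots> = 2 * real k * E" by simp
  finally show ?thesis by (simp only: h_def)
qed

lemma expectation_linear_statistic:
  fixes g :: "'a \<Rightarrow> complex"
  assumes n: "0 < k" "k < n" and xs: "length xs = n"
    and root: "2 * \<theta> * u = u + 1" "2 * \<theta> ^ (n - k) = 1 + u ^ k"
  defines "\<Phi> \<equiv> linear_statistic n g (position_eigenfunction n k \<theta> u)"
  shows "measure_pmf.expectation (gr_kernel (pmf_of_set {n - k, n}) xs) \<Phi> = \<theta> * \<Phi> xs"
proof -
  let ?f = "position_eigenfunction n k \<theta> u"
  have "\<Phi> (move_to_top (n - k) xs) + \<Phi> (move_to_top n xs)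
      = (\<Sum>i<n. g (xs ! i) * (?f (new_index (n - k) i) + ?f (new_index n i)))"
    using n xs by (simp add: \<Phi>_def linear_statistic_move_to_top distrib_left sum.distrib)
  also have "\<dots> = (\<Sum>i<n. g (xs ! i) * (2 * \<theta> * ?f i))"
    using position_eigenfunction_average[OF n(2) _ root] by (intro sum.cong) auto
  also have "\<dots> = 2 * (\<theta> * \<Phi> xs)"
    by (simp add: \<Phi>_def linear_statistic_def sum_distrib_left mult_ac)
  finally show ?thesis
    using n by (subst expectation_gr_kernel_two) (auto simp: scaleR_conv_of_real)
qed

text \<open>
  With two equally likely outcomes the standard deviation is half the distance between them.
\<close>

lemma variance_linear_statistic:
  fixes g :: "'a \<Rightarrow> complex"
  assumes n: "0 < k" "k < n" and xs: "length xs = n"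
    and root: "2 * \<theta> * u = u + 1" "2 * \<theta> ^ (n - k) = 1 + u ^ k"
    and E: "\<And>j. j < k \<Longrightarrow> cmod (u ^ j - u ^ Suc j) \<le> E"
    and M: "\<And>i. i < n \<Longrightarrow> cmod (g (xs ! i)) \<le> M" "M \<ge> 0"
  defines "\<Phi> \<equiv> linear_statistic n g (position_eigenfunction n k \<theta> u)"
  shows "measure_pmf.expectation (gr_kernel (pmf_of_set {n - k, n}) xs) (\<lambda>y. (cmod (\<Phi> y - \<theta> * \<Phi> xs))\<^sup>2)
    \<le> (M * (real k * E))\<^sup>2"
proof -
  let ?f = "position_eigenfunction n k \<theta> u"
  let ?K = "gr_kernel (pmf_of_set {n - k, n}) xs"
  define A where "A = \<Phi> (move_to_top (n - k) xs)"
  define B where "B = \<Phi> (move_to_top n xs)"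
  have mean: "\<theta> * \<Phi> xs = (A + B) / 2"
  proof -
    have "\<theta> * \<Phi> xs = measure_pmf.expectation ?K \<Phi>"
      unfolding \<Phi>_def by (rule expectation_linear_statistic[OF n xs root, symmetric])
    also have "\<dots> = (A + B) / 2"
      unfolding A_def B_def using n by (subst expectation_gr_kernel_two) (auto simp: scaleR_conv_of_real)
    finally show ?thesis .
  qed
  have "A - B = (\<Sum>i<n. g (xs ! i) * (?f (new_index (n - k) i) - ?f (new_index n i)))"
    using n xs unfolding A_def B_def \<Phi>_def
    by (simp add: linear_statistic_move_to_top right_diff_distrib sum_subtractf)
  also have "cmod \<dots> \<le> (\<Sum>i<n. M * cmod (?f (new_index (n - k) i) - ?f (new_index n i)))"
    by (rule order_trans[OF norm_sum])
       (auto simp: norm_mult intro!: sum_mono mult_right_mono M)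
  also have "\<dots> \<le> M * (2 * real k * E)"
    unfolding sum_distrib_left[symmetric]
    using position_eigenfunction_discrepancy[OF n(2) E] M(2) by (intro mult_left_mono) auto
  finally have AB: "cmod (A - B) / 2 \<le> M * (real k * E)" by simp
  have "A - (A + B) / 2 = (A - B) / 2" "B - (A + B) / 2 = - ((A - B) / 2)"
    by (simp_all add: field_simps)
  then have h: "cmod (A - (A + B) / 2) = cmod (A - B) / 2" "cmod (B - (A + B) / 2) = cmod (A - B) / 2"
    by (simp_all only: norm_minus_cancel norm_divide) auto
  have "measure_pmf.expectation ?K (\<lambda>y. (cmod (\<Phi> y - \<theta> * \<Phi> xs))\<^sup>2)
      = (1/2) * ((cmod (A - (A + B) / 2))\<^sup>2 + (cmod (B - (A + B) / 2))\<^sup>2)"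
    unfolding mean A_def B_def using n by (subst expectation_gr_kernel_two) auto
  also have "\<dots> = (cmod (A - B) / 2)\<^sup>2" unfolding h by simp
  also have "\<dots> \<le> (M * (real k * E))\<^sup>2" using AB by (intro power_mono) auto
  finally show ?thesis .
qed

section \<open>Location of the eigenvalue\<close>

lemma sinh_minus_linear_small:
  assumes "\<eta> > 0"
  shows "\<exists>r>0. \<forall>y::complex. norm y \<le> r \<longrightarrow> norm (sinh y - y) \<le> \<eta> * norm y"
proof -
  have "(sinh has_field_derivative cosh 0) (at (0::complex))"
    by (auto intro!: derivative_eq_intros)
  then have "(sinh has_derivative (\<lambda>h. h)) (at (0::complex))"
    unfolding has_field_derivative_def by (rule has_derivative_eq_rhs) auto
  then obtain d where d: "d > 0" "\<And>y::complex. norm (y - 0) < d \<Longrightarrow> norm (sinh y - sinh 0 - (y - 0)) \<le> \<eta> * norm (y - 0)"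
    using assms unfolding has_derivative_at_alt by blast
  show ?thesis
    using d by (intro exI[of _ "d/2"]) auto
qed

text \<open>
  From \<open>cosh x - 1 = 2 * (sinh (x / 2))\<^sup>2\<close> and \<open>sinh y = y + o(y)\<close>. The bound on
  \<open>cosh x - 1\<close> keeps \<open>cosh x\<close> away from the branch cut of the logarithm.
\<close>

lemma Ln_cosh_quadratic:
  assumes "\<eta> > 0"
  shows "\<exists>r>0. \<forall>x::complex. norm x \<le> r \<longrightarrow>
    norm (cosh x - 1) \<le> 1/2 \<and> norm (Ln (cosh x) - x\<^sup>2 / 2) \<le> \<eta> * (norm x)\<^sup>2"
proof -
  define \<delta> where "\<delta> = min 1 \<eta> / 4"
  have \<delta>: "\<delta> > 0" "\<delta> \<le> 1/4" "\<delta> \<le> \<eta>/4" using assms by (auto simp: \<delta>_def)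
  obtain r where r: "r > 0" "\<And>y::complex. norm y \<le> r \<Longrightarrow> norm (sinh y - y) \<le> \<delta> * norm y"
    using sinh_minus_linear_small[OF \<delta>(1)] by blast
  define r' where "r' = min r (min (1/2) \<delta>)"
  have r': "r' > 0" "r' \<le> r" "r' \<le> 1/2" "r' \<le> \<delta>" using r(1) \<delta>(1) by (auto simp: r'_def)
  show ?thesis
  proof (intro exI[of _ r'] conjI allI impI)
    show "r' > 0" by fact
  next
    fix x :: complex assume x: "norm x \<le> r'"
    define y where "y = x / 2"
    have xy: "x = 2 * y" by (simp add: y_def)
    have ny: "norm y = norm x / 2" by (simp add: y_def norm_divide)
    define d where "d = sinh y - y"
    have d: "norm d \<le> \<delta> * norm y"
      using r(2)[of y] x r' ny norm_ge_zero[of x] unfolding d_def by linarith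
    have cosh_eq: "cosh x - 1 = 2 * (y + d)\<^sup>2"
      unfolding xy d_def by (simp add: cosh_double cosh_square_eq)
    have "cosh x - 1 - x\<^sup>2 / 2 = 4 * y * d + 2 * d\<^sup>2"
      unfolding cosh_eq unfolding xy by (simp add: power2_eq_square algebra_simps)
    then have "norm (cosh x - 1 - x\<^sup>2 / 2) \<le> 4 * norm y * norm d + 2 * (norm d)\<^sup>2"
      using norm_triangle_ineq[of "4 * y * d" "2 * d\<^sup>2"] by (simp add: norm_mult norm_power)
    also have "\<dots> \<le> 4 * norm y * (\<delta> * norm y) + 2 * (\<delta> * norm y)\<^sup>2"
      using d by (intro add_mono mult_left_mono power_mono) auto
    also have "\<dots> = (4 * \<delta> + 2 * (\<delta> * \<delta>)) * (norm y)\<^sup>2"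
      by (simp add: power2_eq_square algebra_simps)
    also have "\<dots> \<le> (8 * \<delta>) * (norm y)\<^sup>2"
      using \<delta> by (intro mult_right_mono) (auto simp: mult_left_le)
    finally have c1: "norm (cosh x - 1 - x\<^sup>2 / 2) \<le> 2 * \<delta> * (norm x)\<^sup>2"
      unfolding ny by (simp add: power2_eq_square)
    define z where "z = cosh x - 1"
    have "norm z \<le> norm (x\<^sup>2/2) + norm (z - x\<^sup>2/2)"
      using norm_triangle_ineq[of "x\<^sup>2/2" "z - x\<^sup>2/2"] by simp
    also have "\<dots> \<le> (norm x)\<^sup>2 / 2 + 2 * \<delta> * (norm x)\<^sup>2"
      using c1 by (simp add: z_def norm_divide norm_power)
    also have "\<dots> = (1/2 + 2 * \<delta>) * (norm x)\<^sup>2" by (simp add: algebra_simps)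
    also have "\<dots> \<le> 1 * (norm x)\<^sup>2"
      using \<delta> by (intro mult_right_mono) auto
    finally have nz: "norm z \<le> (norm x)\<^sup>2" by simp
    have x2: "(norm x)\<^sup>2 \<le> \<delta>\<^sup>2" using x r' by (intro power_mono) auto
    have dd: "\<delta>\<^sup>2 \<le> \<delta> * (1/4)" unfolding power2_eq_square using \<delta> by (intro mult_left_mono) auto
    have nz2: "norm z \<le> 1/2" "norm z \<le> \<delta>" using nz x2 dd \<delta> by linarith+
    show "norm (cosh x - 1) \<le> 1/2" using nz2 by (simp add: z_def)
    have "norm (Ln (1 + z) - z) \<le> norm z^2 / (1 - norm z)"
      using nz2 by (intro Ln_approx_linear) auto
    also have "\<dots> \<le> norm z^2 / (1/2)"
      using nz2 by (intro divide_left_mono) auto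
    also have "\<dots> = 2 * (norm z * norm z)" by (simp add: power2_eq_square)
    also have "\<dots> \<le> 2 * (\<delta> * (norm x)\<^sup>2)"
      using nz nz2 \<delta> by (intro mult_left_mono mult_mono) auto
    finally have c2: "norm (Ln (cosh x) - (cosh x - 1)) \<le> 2 * \<delta> * (norm x)\<^sup>2"
      by (simp add: z_def)
    have "norm (Ln (cosh x) - x\<^sup>2/2) \<le> 2 * \<delta> * (norm x)\<^sup>2 + 2 * \<delta> * (norm x)\<^sup>2"
      using norm_triangle_ineq[of "Ln (cosh x) - (cosh x - 1)" "cosh x - 1 - x\<^sup>2/2"] c1 c2 by simp
    also have "\<dots> = 4 * \<delta> * (norm x)\<^sup>2" by simp
    also have "\<dots> \<le> \<eta> * (norm x)\<^sup>2" using \<delta> by (intro mult_right_mono) auto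
    finally show "norm (Ln (cosh x) - x\<^sup>2/2) \<le> \<eta> * (norm x)\<^sup>2" .
  qed
qed

text \<open>
  Solving the two equations for \<open>\<theta>\<close> and \<open>u\<close>. Put \<open>u = exp (- 2 * a)\<close>. The first equation says
  \<open>\<theta> = exp a * cosh a\<close>, and then the second one becomes
  \<open>exp (n * a) * cosh a ^ (n - k) = cosh (k * a)\<close>. With \<open>l x = Ln (cosh x)\<close>, a solution for which
  the phase advances by one full turn per circuit of the deck is a fixed point of
  \<open>a = (2 * pi * \<i> - (n - k) * l a + l (k * a)) / n\<close>. As \<open>l x\<close> is close to \<open>x\<^sup>2 / 2\<close>, for small \<open>k / n\<close>
  the right-hand side maps a disc of radius \<open>8 / n\<close> into itself, and Brouwer's theorem applies.
  The fixed point is near \<open>2 * pi * \<i> / n\<close>, and \<open>w = a + l a\<close>, a logarithm of \<open>\<theta>\<close>, satisfies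
  \<open>n * w = 2 * pi * \<i> + k * l a + l (k * a)\<close>. The real part of the right-hand side is close to that of
  \<open>(k + k\<^sup>2) * a\<^sup>2 / 2\<close>, which gives the decay rate \<open>2 * pi\<^sup>2 * k * (k + 1) / n ^ 3\<close>.
\<close>

lemma characteristic_root:
  assumes "\<eta> > 0"
  shows "\<exists>\<rho>>0. \<forall>n k :: nat. 1 \<le> k \<and> k < n \<and> real k \<le> \<rho> * real n \<longrightarrow>
    (\<exists>a w :: complex. norm a \<le> 8 / real n \<and> exp w = exp a * cosh a
       \<and> exp (of_nat n * a) * cosh a ^ (n - k) = cosh (of_nat k * a)
       \<and> \<bar>Re w + 2 * pi\<^sup>2 * (real k * (real k + 1)) / real n ^ 3\<bar> \<le> \<eta> * (real k * (real k + 1)) / real n ^ 3)"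
proof -
  define \<delta> where "\<delta> = min (1/2) (\<eta> / 128)"
  have \<delta>: "\<delta> > 0" "\<delta> \<le> 1/2" "64 * \<delta> \<le> \<eta>/2" using assms by (auto simp: \<delta>_def)
  obtain r where r: "r > 0" "\<And>x::complex. norm x \<le> r \<Longrightarrow> norm (cosh x - 1) \<le> 1/2"
    "\<And>x::complex. norm x \<le> r \<Longrightarrow> norm (Ln (cosh x) - x\<^sup>2 / 2) \<le> \<delta> * (norm x)\<^sup>2"
    using Ln_cosh_quadratic[OF \<delta>(1)] by blast
  define l where "l = (\<lambda>x::complex. Ln (cosh x))"
  have cosh_pos: "cosh x \<notin> \<real>\<^sub>\<le>\<^sub>0" if "norm x \<le> r" for x :: complex
  proof
    assume "cosh x \<in> \<real>\<^sub>\<le>\<^sub>0"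
    moreover have "\<bar>Re (cosh x - 1)\<bar> \<le> 1/2"
      using r(2)[OF that] abs_Re_le_cmod order_trans by blast
    ultimately show False by (auto simp: complex_nonpos_Reals_iff)
  qed
  have exp_l: "exp (l x) = cosh x" if "norm x \<le> r" for x :: complex
    using cosh_pos[OF that] unfolding l_def by (intro exp_Ln) auto
  have cont_l: "continuous_on {x. norm x \<le> r} l"
    unfolding l_def using cosh_pos by (auto intro!: continuous_intros continuous_on_Ln)
  have l_approx: "norm (l x - x\<^sup>2/2) \<le> \<delta> * (norm x)\<^sup>2" if "norm x \<le> r" for x :: complex
    using r(3)[OF that] by (simp add: l_def)
  have l_bound: "norm (l x) \<le> (norm x)\<^sup>2" if "norm x \<le> r" for x :: complex
  proof -
    have "norm (l x) \<le> norm (x\<^sup>2/2) + norm (l x - x\<^sup>2/2)"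
      using norm_triangle_ineq[of "x\<^sup>2/2" "l x - x\<^sup>2/2"] by simp
    also have "\<dots> \<le> (norm x)\<^sup>2/2 + 1/2 * (norm x)\<^sup>2"
      using order_trans[OF l_approx[OF that] mult_right_mono[OF \<delta>(2)]]
      by (intro add_mono) (auto simp: norm_divide norm_power)
    finally show ?thesis by simp
  qed
  \<comment> \<open>Two errors share the tolerance \<open>\<eta>\<close>: \<open>\<delta>\<close> for replacing \<open>l x\<close> by \<open>x\<^sup>2 / 2\<close>,
    and \<open>\<beta>\<close> for replacing \<open>a\<close> by \<open>2 * pi * \<i> / n\<close>.\<close>
  define \<beta> where "\<beta> = min 1 (\<eta> / 16)"
  have \<beta>: "\<beta> > 0" "\<beta> \<le> 1" "8 * \<beta> \<le> \<eta>/2" using assms by (auto simp: \<beta>_def)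
  define \<rho> where "\<rho> = min 1 (min (r / 8) (\<beta> / 128))"
  have \<rho>: "\<rho> > 0" "\<rho> \<le> 1" "8 * \<rho> \<le> r" "128 * \<rho> \<le> \<beta>" using r(1) \<beta> by (auto simp: \<rho>_def)
  show ?thesis
  proof (intro exI[of _ \<rho>] conjI allI impI, goal_cases)
    case 1 show ?case by fact
  next
    case (2 n k)
    then have k: "1 \<le> k" "k < n" and kn: "real k \<le> \<rho> * real n" by auto
    define N where "N = real n"
    have N: "N > 0" "real n = N" using k by (auto simp: N_def)
    have kN: "real k / N \<le> \<rho>" using kn N by (simp add: field_simps)
    have "1 / N \<le> real k / N" using k N by (intro divide_right_mono) auto
    with kN have N1: "1 / N \<le> \<rho>" by simp
    define c where "c = 2 * complex_of_real pi * \<i>"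
    have nc: "norm c = 2 * pi" by (simp add: c_def norm_mult)
    have npi: "2 * pi \<le> 7" using pi_approx by simp
    \<comment> \<open>The fixed points of \<open>G\<close> are the roots sought; its values are close to \<open>c / N\<close>.\<close>
    define G where "G = (\<lambda>a. (c - of_nat (n - k) * l a + l (of_nat k * a)) / of_real N)"
    have small: "norm a \<le> r \<and> norm (of_nat k * a) \<le> r" if "norm a \<le> 8 / N" for a :: complex
    proof -
      have "norm (of_nat k * a) = real k * norm a" by (simp add: norm_mult)
      also have "\<dots> \<le> real k * (8 / N)" using that by (intro mult_left_mono) auto
      also have "\<dots> = 8 * (real k / N)" by simp
      also have "\<dots> \<le> r" using kN \<rho> by linarith
      finally show ?thesis using that N1 \<rho> by auto
    qed
    have Gc: "norm (G a - c / of_real N) \<le> \<beta> / N" if a: "norm a \<le> 8 / N" for a :: complex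
    proof -
      have sq: "(norm a)\<^sup>2 \<le> (8/N)\<^sup>2" using a by (intro power_mono) auto
      have "norm (of_nat (n - k) * l a) = real (n - k) * norm (l a)" by (simp add: norm_mult)
      also have "\<dots> \<le> N * (8/N)\<^sup>2"
        using order_trans[OF l_bound[OF conjunct1[OF small[OF a]]] sq] k by (intro mult_mono) (auto simp: N_def)
      also have "\<dots> = 64 * (1/N)" using N by (simp add: power2_eq_square)
      also have "\<dots> \<le> 64 * \<rho>" using N1 by simp
      finally have t1: "norm (of_nat (n - k) * l a) \<le> 64 * \<rho>" .
      have "norm (l (of_nat k * a)) \<le> (norm (of_nat k * a))\<^sup>2"
        using l_bound small[OF a] by blast
      also have "\<dots> = (real k)\<^sup>2 * (norm a)\<^sup>2" by (simp add: norm_mult power_mult_distrib)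
      also have "\<dots> \<le> (real k)\<^sup>2 * (8/N)\<^sup>2" using sq by (intro mult_left_mono) auto
      also have "\<dots> = 64 * ((real k / N) * (real k / N))" by (simp add: power2_eq_square)
      also have "\<dots> \<le> 64 * (\<rho> * 1)"
        using kN \<rho> N k by (intro mult_left_mono mult_mono) auto
      finally have t2: "norm (l (of_nat k * a)) \<le> 64 * \<rho>" by simp
      have "G a - c / of_real N = (l (of_nat k * a) - of_nat (n - k) * l a) / of_real N"
        unfolding G_def by (simp add: diff_divide_distrib add_divide_distrib)
      then have "norm (G a - c / of_real N) = norm (l (of_nat k * a) - of_nat (n - k) * l a) / N"
        using N by (simp add: norm_divide)
      also have "\<dots> \<le> \<beta> / N"
        using norm_triangle_ineq4[of "l (of_nat k * a)" "of_nat (n - k) * l a"] t1 t2 \<rho> N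
        by (intro divide_right_mono) auto
      finally show ?thesis .
    qed
    have "\<exists>a::complex. norm a \<le> 8 / N \<and> G a = a"
    proof -
      have "continuous_on (cball 0 (8/N)) (\<lambda>a. l a)"
        by (rule continuous_on_subset[OF cont_l]) (use small in auto)
      moreover have "continuous_on (cball 0 (8/N)) (\<lambda>a. l (of_nat k * a))"
        by (rule continuous_on_compose2[OF cont_l]) (use small in \<open>auto intro!: continuous_intros\<close>)
      ultimately have "continuous_on (cball 0 (8/N)) G"
        unfolding G_def using N by (auto intro!: continuous_intros)
      moreover have "G \<in> cball 0 (8/N) \<rightarrow> cball 0 (8/N)"
      proof
        fix a :: complex assume "a \<in> cball 0 (8/N)"
        then have "norm (G a - c / of_real N) \<le> \<beta> / N" using Gc by simp
        moreover have "norm (c / of_real N) = 2 * pi / N" using nc N by (simp add: norm_divide)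
        ultimately have "norm (G a) \<le> 2 * pi / N + \<beta> / N"
          using norm_triangle_ineq[of "c / of_real N" "G a - c / of_real N"] by simp
        also have "\<dots> \<le> 8 / N"
          using npi \<beta> N unfolding add_divide_distrib[symmetric] by (intro divide_right_mono) auto
        finally show "G a \<in> cball 0 (8/N)" by simp
      qed
      ultimately obtain a :: complex where "a \<in> cball 0 (8/N)" "G a = a"
        using brouwer[of "cball 0 (8/N)" G] N by auto
      then show ?thesis by auto
    qed
    then obtain a where a: "norm a \<le> 8 / N" "G a = a" by blast
    note sm = small[OF a(1)]
    define w where "w = a + l a"
    have fix_eq: "of_nat n * a = c - of_nat (n - k) * l a + l (of_nat k * a)"
    proof -
      have "of_nat n * a = of_real N * G a" using a by (simp add: N_def)
      then show ?thesis unfolding G_def using N by simp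
    qed
    have e1: "exp w = exp a * cosh a" using exp_l sm by (simp add: w_def exp_add)
    have "exp (of_nat n * a) * cosh a ^ (n - k) = exp (of_nat n * a + of_nat (n - k) * l a)"
      using exp_l sm by (simp add: exp_add exp_of_nat_mult)
    also have "\<dots> = exp (c + l (of_nat k * a))" unfolding fix_eq by simp
    also have "\<dots> = cosh (of_nat k * a)" using exp_l sm by (simp add: exp_add c_def)
    finally have e2: "exp (of_nat n * a) * cosh a ^ (n - k) = cosh (of_nat k * a)" .
    have nw: "of_real N * w = c + (of_nat k * l a + l (of_nat k * a))"
      using fix_eq k by (simp add: w_def N_def algebra_simps of_nat_diff)
    define q where "q = of_nat k * l a + l (of_nat k * a)"
    define kk where "kk = real k * (real k + 1)"
    have kk: "kk \<ge> 0" by (simp add: kk_def)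
    have sq: "(norm a)\<^sup>2 \<le> 64 / N\<^sup>2"
      using power_mono[OF a(1), of 2] by (simp add: power_divide)
    have q1: "norm (q - of_real kk * a\<^sup>2 / 2) \<le> kk * (64 * \<delta>) / N\<^sup>2"
    proof -
      have "q - of_real kk * a\<^sup>2 / 2 = of_nat k * (l a - a\<^sup>2/2) + (l (of_nat k * a) - (of_nat k * a)\<^sup>2 / 2)"
        unfolding q_def kk_def by (simp add: power2_eq_square field_simps)
      also have "norm \<dots> \<le> real k * (\<delta> * (norm a)\<^sup>2) + \<delta> * (norm (of_nat k * a))\<^sup>2"
      proof (rule norm_triangle_le[OF add_mono])
        show "norm (of_nat k * (l a - a\<^sup>2/2)) \<le> real k * (\<delta> * (norm a)\<^sup>2)"
          using l_approx[of a] sm by (auto simp: norm_mult intro!: mult_left_mono)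
        show "norm (l (of_nat k * a) - (of_nat k * a)\<^sup>2 / 2) \<le> \<delta> * (norm (of_nat k * a))\<^sup>2"
          using l_approx sm by blast
      qed
      also have "\<dots> = kk * \<delta> * (norm a)\<^sup>2"
        by (simp add: kk_def norm_mult power2_eq_square algebra_simps)
      also have "\<dots> \<le> kk * \<delta> * (64 / N\<^sup>2)" using sq kk \<delta> by (intro mult_left_mono) auto
      finally show ?thesis by (simp add: mult_ac)
    qed
    have q2: "norm (a\<^sup>2 - (c / of_real N)\<^sup>2) \<le> 16 * \<beta> / N\<^sup>2"
    proof -
      have nc': "norm (c / of_real N) \<le> 8 / N"
        using nc npi N by (simp add: norm_divide divide_right_mono)
      have "norm (a\<^sup>2 - (c / of_real N)\<^sup>2) = norm (a - c / of_real N) * norm (a + c / of_real N)"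
        by (simp only: power2_eq_square square_diff_square_factored norm_mult mult.commute)
      also have "\<dots> \<le> (\<beta> / N) * (16 / N)"
        using Gc[OF a(1)] a norm_triangle_ineq[of a "c / of_real N"] nc' N \<beta> by (intro mult_mono) auto
      finally show ?thesis by (simp add: power2_eq_square mult_ac)
    qed
    have c2: "(c / of_real N)\<^sup>2 = of_real (- 4 * pi\<^sup>2 / N\<^sup>2)"
      unfolding c_def by (simp add: power_divide power_mult_distrib)
    have "\<bar>Re q + 2 * pi\<^sup>2 * kk / N\<^sup>2\<bar> \<le> \<eta> * kk / N\<^sup>2"
    proof -
      have e: "Re (q - of_real (- 2 * pi\<^sup>2 * kk / N\<^sup>2)) = Re q + 2 * pi\<^sup>2 * kk / N\<^sup>2"
        by simp
      have "q - of_real (- 2 * pi\<^sup>2 * kk / N\<^sup>2)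
         = (q - of_real kk * a\<^sup>2 / 2) + of_real kk / 2 * (a\<^sup>2 - (c / of_real N)\<^sup>2)"
        unfolding c2 by (simp add: algebra_simps)
      also have "norm \<dots> \<le> kk * (64 * \<delta>) / N\<^sup>2 + kk / 2 * (16 * \<beta> / N\<^sup>2)"
        using q1 mult_left_mono[OF q2, of "kk / 2"] kk
        by (intro norm_triangle_le add_mono) (simp_all add: norm_mult)
      also have "\<dots> = kk * (64 * \<delta> + 8 * \<beta>) / N\<^sup>2" by (simp add: algebra_simps add_divide_distrib)
      also have "\<dots> \<le> kk * \<eta> / N\<^sup>2"
        using \<delta> \<beta> kk by (intro divide_right_mono mult_left_mono) auto
      finally have "norm (q - of_real (- 2 * pi\<^sup>2 * kk / N\<^sup>2)) \<le> \<eta> * kk / N\<^sup>2" by (simp add: mult_ac)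
      then show ?thesis using e abs_Re_le_cmod order_trans by metis
    qed
    moreover have "Re w = Re q / N"
    proof -
      have "Re (of_real N * w) = Re q" unfolding nw q_def by (simp add: c_def)
      then show ?thesis using N by (simp add: field_simps)
    qed
    ultimately have b: "\<bar>Re q + 2 * pi\<^sup>2 * kk / N\<^sup>2\<bar> \<le> \<eta> * kk / N\<^sup>2" and w: "Re w = Re q / N"
      by blast+
    have "Re w + 2 * pi\<^sup>2 * kk / N ^ 3 = (Re q + 2 * pi\<^sup>2 * kk / N\<^sup>2) / N"
      unfolding w by (simp add: add_divide_distrib power2_eq_square power3_eq_cube)
    then have "\<bar>Re w + 2 * pi\<^sup>2 * kk / N ^ 3\<bar> = \<bar>Re q + 2 * pi\<^sup>2 * kk / N\<^sup>2\<bar> / N"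
      using N by (simp add: abs_divide)
    also have "\<dots> \<le> (\<eta> * kk / N\<^sup>2) / N"
      using b N by (intro divide_right_mono) auto
    also have "\<dots> = \<eta> * kk / N ^ 3"
      by (simp add: power2_eq_square power3_eq_cube)
    finally have "\<bar>Re w + 2 * pi\<^sup>2 * kk / N ^ 3\<bar> \<le> \<eta> * kk / N ^ 3" .
    then show ?case
      using a(1) e1 e2 unfolding kk_def N_def by (intro exI[of _ a] exI[of _ w]) auto
  qed
qed

section \<open>The lower bound for the shuffle\<close>

lemma exp_Lipschitz:
  fixes x y :: complex
  assumes "norm x \<le> B" "norm y \<le> B"
  shows "norm (exp x - exp y) \<le> exp B * norm (x - y)"
proof (rule field_differentiable_bound[of "cball 0 B" exp exp])
  show "(exp has_field_derivative exp z) (at z within cball 0 B)" for z :: complex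
    by (rule DERIV_subset[OF DERIV_exp]) auto
  show "norm (exp z) \<le> exp B" if "z \<in> cball 0 B" for z :: complex
    using that norm_exp[of z] by (smt (verit) exp_le_cancel_iff mem_cball_0)
qed (use assms in auto)

text \<open>
  Wilson's bound for the statistic that starts with all terms in phase: card \<open>c\<close> carries the conjugate
  of the eigenfunction at its initial position, so that \<open>\<Phi>\<close> is initially of order \<open>n\<close>. The noise
  of one step has variance of order \<open>k\<^sup>2 / n\<^sup>2\<close> and the spectral gap is of order \<open>k\<^sup>2 / n ^ 3\<close>, so
  the stationary variance is of order \<open>n\<close>. If the laws are close after \<open>t\<close> steps, then
  \<open>n\<^sup>2 * (cmod \<theta>) ^ (2 * t)\<close> is at most of order \<open>n\<close>. The numerical constants are crude, as they only
  enter \<open>C\<close>.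
\<close>

lemma tv_close_imp_ln_le:
  fixes C :: real
  defines "C \<equiv> ln (368/3 * 256 * exp 164)"
  assumes n: "1 \<le> k" "k < n"
    and a: "cmod a \<le> 8 / real n" and w: "exp w = exp a * cosh a"
    and root: "exp (of_nat n * a) * cosh a ^ (n - k) = cosh (of_nat k * a)"
    and Re_w: "\<bar>Re w + 2 * pi\<^sup>2 * (real k * (real k + 1)) / real n ^ 3\<bar> \<le> \<eta> * (real k * (real k + 1)) / real n ^ 3"
    and \<eta>: "\<eta> \<le> 1"
    and close: "tv_dist (decks n) (chain_law (gr_kernel (pmf_of_set {n - k, n})) [1..<Suc n] t)
       (pmf_of_set (decks n)) \<le> 1/4"
  shows "ln (real n) \<le> C + real t * ((4 * pi\<^sup>2 + 2 * \<eta>) * (real k * (real k + 1)) / real n ^ 3)"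
proof -
  define N where "N = real n"
  have N: "N > 0" "N \<ge> 1" using n by (auto simp: N_def)
  define kk where "kk = real k * (real k + 1)"
  have "real k + 1 \<le> N" using n by (simp add: N_def)
  then have "kk \<le> N * N" unfolding kk_def by (intro mult_mono) auto
  moreover have "kk > 0" using n by (simp add: kk_def)
  ultimately have kk: "(real k)\<^sup>2 \<le> kk" "kk > 0" "kk \<le> N * N"
    by (simp_all add: kk_def power2_eq_square distrib_left)
  \<comment> \<open>The decay rate: \<open>cmod \<theta> = exp (- x)\<close>.\<close>
  define x where "x = - Re w"
  have x_eq: "\<bar>x - 2 * pi\<^sup>2 * kk / N ^ 3\<bar> \<le> \<eta> * kk / N ^ 3"
    using Re_w by (simp add: x_def kk_def N_def abs_minus_commute)
  have pi2: "9 \<le> pi\<^sup>2" "pi\<^sup>2 \<le> 10.24"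
    using power_mono[of 3 pi 2] power_mono[of pi "32/10" 2] pi_approx by (auto simp: power2_eq_square)
  have x_low: "kk / N ^ 3 \<le> x"
  proof -
    have "kk / N ^ 3 \<le> (2 * pi\<^sup>2 - \<eta>) * (kk / N ^ 3)"
      using mult_right_mono[of 1 "2 * pi\<^sup>2 - \<eta>" "kk / N ^ 3"] pi2 \<eta> kk N by simp
    then show ?thesis using x_eq by (simp add: left_diff_distrib diff_divide_distrib)
  qed
  have x_up: "2 * x \<le> (4 * pi\<^sup>2 + 2 * \<eta>) * kk / N ^ 3"
  proof -
    have "(4 * pi\<^sup>2 + 2 * \<eta>) * kk / N ^ 3 = 2 * (2 * pi\<^sup>2 * kk / N ^ 3) + 2 * (\<eta> * kk / N ^ 3)"
      by (simp add: distrib_right add_divide_distrib)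
    then show ?thesis using abs_le_D1[OF x_eq] by linarith
  qed
  have x_pos: "x > 0" using less_le_trans[OF divide_pos_pos[OF kk(2)] x_low] N by simp
  have x_N: "x \<le> 22 / N"
  proof -
    have "2 * x \<le> 44 * kk / N ^ 3"
      using pi2 \<eta> kk N by (intro order_trans[OF x_up] divide_right_mono mult_right_mono) auto
    also have "\<dots> \<le> 44 * (N * N) / N ^ 3"
      using kk N by (intro divide_right_mono mult_left_mono) auto
    also have "\<dots> = 44 / N" using N by (simp add: power3_eq_cube)
    finally show ?thesis by simp
  qed
  define \<theta> where "\<theta> = exp w"
  define u where "u = exp (- 2 * a)"
  have lam_u: "2 * \<theta> * u = u + 1"
  proof -
    have "2 * (exp a * cosh a) = exp (2 * a) + 1"
      by (simp add: cosh_def scaleR_conv_of_real algebra_simps flip: exp_add)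
    then show ?thesis unfolding \<theta>_def w u_def
      by (simp add: distrib_right flip: exp_add mult.assoc)
  qed
  have lam_pow: "2 * \<theta> ^ (n - k) = 1 + u ^ k"
  proof -
    have "\<theta> ^ (n - k) = exp (of_nat (n - k) * a) * cosh a ^ (n - k)"
      by (simp add: \<theta>_def w power_mult_distrib exp_of_nat_mult)
    also have "of_nat (n - k) * a = of_nat n * a + - (of_nat k * a)"
      using n by (simp add: of_nat_diff algebra_simps)
    also have "exp \<dots> * cosh a ^ (n - k) = exp (- (of_nat k * a)) * cosh (of_nat k * a)"
      unfolding exp_add root[symmetric] by simp
    finally have "2 * \<theta> ^ (n - k) = 2 * (exp (- (of_nat k * a)) * cosh (of_nat k * a))" by simp
    also have "\<dots> = 1 + exp (of_nat k * (- 2 * a))"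
      by (simp add: cosh_def scaleR_conv_of_real algebra_simps flip: exp_add)
    finally show ?thesis unfolding u_def exp_of_nat_mult .
  qed
  have norm_lam: "cmod \<theta> = exp (- x)" by (simp add: \<theta>_def x_def)
  have u_pow: "u ^ j = exp (of_nat j * (- 2 * a))" for j
    unfolding u_def by (rule exp_of_nat_mult[symmetric])
  have arg: "cmod (of_nat j * (- 2 * a)) \<le> 16" if "j \<le> n" for j
  proof -
    have "cmod (of_nat j * (- 2 * a)) = real j * (2 * cmod a)" by (simp add: norm_mult)
    also have "\<dots> \<le> N * (2 * (8 / N))" using a that by (intro mult_mono) (auto simp: N_def)
    finally show ?thesis using N by simp
  qed
  define f where "f = position_eigenfunction n k \<theta> u"
  \<comment> \<open>The exponents that occur are at most 22 and 16 in modulus, as \<open>n * x \<le> 22\<close> and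
    \<open>n * cmod (2 * a) \<le> 16\<close>.\<close>
  have f_bounds: "exp (- 22) \<le> cmod (f i) \<and> cmod (f i) \<le> exp 22" if i: "i < n" for i
  proof (cases "i < n - k")
    case True
    have "real i * x \<le> N * (22 / N)" using x_N x_pos i by (intro mult_mono) (auto simp: N_def)
    then have "real i * x \<le> 22" "0 \<le> real i * x" using N x_pos by auto
    moreover have "cmod (f i) = exp (- (real i * x))"
      using True by (simp add: f_def position_eigenfunction_def norm_power norm_lam flip: exp_of_nat_mult)
    ultimately show ?thesis by simp
  next
    case False
    define z where "z = of_nat (n - i) * (- 2 * a)"
    have "cmod (f i) = exp (Re z)"
      using False by (simp only: f_def position_eigenfunction_def u_pow norm_exp_eq_Re if_False z_def)
    moreover have "\<bar>Re z\<bar> \<le> 16"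
      using arg[of "n - i"] abs_Re_le_cmod[of z] unfolding z_def by linarith
    ultimately show ?thesis by auto
  qed
  define E where "E = exp 16 * (16 / N)"
  have u_step: "cmod (u ^ j - u ^ Suc j) \<le> E" if "j < k" for j
  proof -
    have "cmod (u ^ j - u ^ Suc j) \<le> exp 16 * cmod (of_nat j * (- 2 * a) - of_nat (Suc j) * (- 2 * a))"
      unfolding u_pow by (rule exp_Lipschitz; rule arg) (use that n in auto)
    also have "of_nat j * (- 2 * a) - of_nat (Suc j) * (- 2 * a) = 2 * a" by (simp add: algebra_simps)
    also have "exp 16 * cmod (2 * a) \<le> exp 16 * (16 / N)"
      using a by (intro mult_left_mono) (simp_all add: norm_mult N_def)
    finally show ?thesis by (simp add: E_def)
  qed
  \<comment> \<open>Cards are numbered from 1; card \<open>c\<close> starts at list index \<open>c - 1\<close>.\<close>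
  define g where "g = (\<lambda>c. cnj (f (c - 1)))"
  have g_bound: "cmod (g (xs ! i)) \<le> exp 22" if "xs \<in> decks n" "i < n" for xs i
  proof -
    have "xs ! i \<in> {1..n}" using that length_deck[OF that(1)] nth_mem[of i xs] by (simp add: decks_mem_iff)
    then have "xs ! i - 1 < n" using n by auto
    then show ?thesis using f_bounds by (simp add: g_def)
  qed
  define \<Phi> where "\<Phi> = linear_statistic n g f"
  define R where "R = (exp 22 * (real k * E))\<^sup>2"
  define s0 where "s0 = [1..<Suc n]"
  have s0: "s0 \<in> decks n" by (auto simp: decks_mem_iff s0_def)
  have "3/4 * (cmod (\<theta> ^ t * \<Phi> s0))\<^sup>2 \<le> 4 * (R / (1 - (cmod \<theta>)\<^sup>2))"
  proof (rule wilson_lower_bound[where S = "decks n" and K = "gr_kernel (pmf_of_set {n - k, n})"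
        and \<nu> = "pmf_of_set (decks n)" and \<Phi> = \<Phi> and x = s0])
    show "tv_dist (decks n) (chain_law (gr_kernel (pmf_of_set {n - k, n})) s0 t) (pmf_of_set (decks n)) \<le> 1/4"
      using close by (simp add: s0_def)
    show "set_pmf (gr_kernel (pmf_of_set {n - k, n}) s) \<subseteq> decks n" if "s \<in> decks n" for s
      using that n by (intro set_gr_kernel) auto
    show "measure_pmf.expectation (gr_kernel (pmf_of_set {n - k, n}) s) \<Phi> = \<theta> * \<Phi> s" if "s \<in> decks n" for s
      unfolding \<Phi>_def f_def using n length_deck[OF that] lam_u lam_pow
      by (intro expectation_linear_statistic) auto
    show "measure_pmf.expectation (gr_kernel (pmf_of_set {n - k, n}) s) (\<lambda>y. (cmod (\<Phi> y - \<theta> * \<Phi> s))\<^sup>2) \<le> R"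
      if "s \<in> decks n" for s
      unfolding \<Phi>_def f_def R_def using n length_deck[OF that] lam_u lam_pow u_step g_bound[OF that]
      by (intro variance_linear_statistic) auto
    show "bind_pmf (pmf_of_set (decks n)) (gr_kernel (pmf_of_set {n - k, n})) = pmf_of_set (decks n)"
      using n by (intro uniform_stationary) auto
    show "cmod \<theta> < 1" using norm_lam x_pos by simp
  qed (use finite_decks decks_nonempty s0 in auto)
  also have "R / (1 - (cmod \<theta>)\<^sup>2) \<le> R / (kk / (23 * N ^ 3))"
  proof (rule divide_left_mono)
    have "(cmod \<theta>)\<^sup>2 = 1 / exp (2 * x)"
      unfolding norm_lam by (simp add: exp_minus field_simps flip: exp_double)
    also have "\<dots> \<le> 1 / (1 + 2 * x)"
      using exp_ge_add_one_self[of "2 * x"] x_pos by (intro divide_left_mono) auto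
    finally have "1 - (cmod \<theta>)\<^sup>2 \<ge> 2 * x / (1 + 2 * x)"
      using x_pos by (simp add: field_simps)
    \<comment> \<open>\<open>1 + 2 * x\<close> is at most 45 because \<open>x \<le> 22\<close>.\<close>
    moreover have "2 * x / (1 + 2 * x) \<ge> 2 * x / 46"
    proof (rule divide_left_mono)
      have "22 / N \<le> 22" using N by (simp add: field_simps)
      then show "1 + 2 * x \<le> 46" using x_N by linarith
    qed (use x_pos in auto)
    ultimately show "kk / (23 * N ^ 3) \<le> 1 - (cmod \<theta>)\<^sup>2" using x_low by simp
    show "0 < (1 - (cmod \<theta>)\<^sup>2) * (kk / (23 * N ^ 3))"
      using norm_lam x_pos kk N by (auto intro!: mult_pos_pos simp: power_less_one_iff)
  qed (simp add: R_def)
  also have "R / (kk / (23 * N ^ 3)) = 23 * 256 * exp 76 * N * ((real k)\<^sup>2 / kk)"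
  proof -
    have e: "(exp 22 :: real)\<^sup>2 * (exp 16)\<^sup>2 = exp 76"
      by (simp add: power2_eq_square flip: exp_add)
    have "R = (exp 22)\<^sup>2 * (exp 16)\<^sup>2 * (256 * (real k)\<^sup>2 / N\<^sup>2)"
      by (simp add: R_def E_def power_mult_distrib power_divide)
    then have "R = exp 76 * (256 * (real k)\<^sup>2 / N\<^sup>2)" unfolding e .
    then show ?thesis using N kk by (simp add: field_simps power2_eq_square power3_eq_cube)
  qed
  also have "\<dots> \<le> 23 * 256 * exp 76 * N * 1"
    using kk N by (intro mult_left_mono) auto
  finally have upper: "3/4 * (cmod (\<theta> ^ t * \<Phi> s0))\<^sup>2 \<le> 92 * 256 * exp 76 * N" by simp
  have "\<Phi> s0 = (\<Sum>i<n. complex_of_real ((cmod (f i))\<^sup>2))"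
    unfolding \<Phi>_def linear_statistic_def s0_def g_def
    by (intro sum.cong) (auto simp: nth_upt complex_norm_square mult.commute
        simp del: upt_Suc of_real_power)
  then have "cmod (\<Phi> s0) = (\<Sum>i<n. (cmod (f i))\<^sup>2)"
    unfolding of_real_sum[symmetric] by (simp add: sum_nonneg del: of_real_sum of_real_power)
  also have "\<dots> \<ge> (\<Sum>i<n. (exp (- 22))\<^sup>2)"
    using f_bounds by (intro sum_mono power_mono) auto
  finally have "cmod (\<Phi> s0) \<ge> N * exp (- 44)"
    by (simp add: N_def flip: exp_double)
  then have "(N * exp (- 44))\<^sup>2 \<le> (cmod (\<Phi> s0))\<^sup>2" using N by (intro power_mono) auto
  then have start: "N\<^sup>2 * exp (- 88) \<le> (cmod (\<Phi> s0))\<^sup>2"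
    by (simp add: power_mult_distrib flip: exp_double)
  have "(cmod (\<theta> ^ t))\<^sup>2 = exp (- (2 * x * t))"
    by (simp add: norm_power norm_lam mult_ac flip: exp_of_nat_mult exp_double)
  then have "exp (- (2 * x * t)) * (N\<^sup>2 * exp (- 88)) \<le> (cmod (\<theta> ^ t * \<Phi> s0))\<^sup>2"
    using start by (simp add: norm_mult power_mult_distrib)
  also have "\<dots> \<le> 368/3 * 256 * exp 76 * N" using upper by simp
  finally have "N * (N * (exp (- (2 * x * t)) * exp (- 88))) \<le> N * (368/3 * 256 * exp 76)"
    by (simp add: power2_eq_square mult_ac)
  then have "N * (exp (- (2 * x * t)) * exp (- 88)) \<le> 368/3 * 256 * exp 76"
    using N(1) by (rule mult_left_le_imp_le)
  then have "N * (exp (- (2 * x * t)) * exp (- 88)) * (exp (2 * x * t) * exp 88)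
      \<le> 368/3 * 256 * exp 76 * (exp (2 * x * t) * exp 88)"
    by (intro mult_right_mono) auto
  also have "N * (exp (- (2 * x * t)) * exp (- 88)) * (exp (2 * x * t) * exp 88) = N"
    by (simp add: mult.assoc flip: exp_add)
  also have "368/3 * 256 * exp 76 * (exp (2 * x * t) * exp 88) = 368/3 * 256 * exp 164 * exp (2 * x * t)"
    by (simp flip: exp_add)
  finally have "N \<le> 368/3 * 256 * exp 164 * exp (2 * x * t)" .
  then have "ln N \<le> ln (368/3 * 256 * exp 164 * exp (2 * x * t))" using N by simp
  also have "\<dots> = ln (368/3 * 256 * exp 164) + 2 * x * t"
    by (subst ln_mult) auto
  also have "\<dots> \<le> C + t * ((4 * pi\<^sup>2 + 2 * \<eta>) * kk / N ^ 3)"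
    unfolding C_def using mult_left_mono[OF x_up, of "real t"] by (intro add_mono) (auto simp: mult_ac)
  finally show ?thesis by (simp add: N_def kk_def)
qed

lemma mixing_time_ge:
  assumes "s \<in> S" and "\<And>t. tv_dist S (chain_law K s t) \<nu> \<le> 1/4 \<Longrightarrow> r \<le> real t"
  shows "ereal r \<le> ereal_of_enat (mixing_time S K \<nu>)"
proof (cases "mixing_time S K \<nu>")
  case (enat m)
  define T where "T = {t. tv_dist S (chain_law K s t) \<nu> \<le> 1/4}"
  have le: "(INF t\<in>T. enat t) \<le> enat m"
    unfolding enat[symmetric] mixing_time_def T_def by (rule SUP_upper[OF assms(1)])
  have "\<exists>t\<in>T. t \<le> m"
  proof (rule ccontr)
    assume "\<not> (\<exists>t\<in>T. t \<le> m)"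
    then have "enat (Suc m) \<le> (INF t\<in>T. enat t)"
      by (intro INF_greatest) (auto simp: not_le Suc_le_eq)
    then have "enat (Suc m) \<le> enat m" using le by (rule order_trans)
    then show False by simp
  qed
  then obtain t where "t \<in> T" "t \<le> m" by blast
  then show ?thesis using assms(2)[of t] enat by (auto simp: T_def)
qed auto

text \<open>
  Solving the inequality between \<open>ln n\<close> and \<open>t\<close> for \<open>t\<close>. The constant \<open>C\<close> is negligible against
  \<open>\<delta> * ln n\<close> for large \<open>n\<close>, and the tolerance \<open>\<delta>\<close> in the decay rate costs a factor of at most
  \<open>1 + \<delta> / 2\<close>.
\<close>

lemma gr_mixing_time_lower_bound:
  assumes "0 < \<delta>" "\<delta> < 1"
  shows "\<exists>\<rho>>0. \<exists>n0. \<forall>n\<ge>n0. \<forall>k. 1 \<le> k \<and> k < n \<and> real k \<le> \<rho> * real n \<longrightarrow>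
    ereal ((1 - \<delta>) * (real n ^ 3 / (4 * pi\<^sup>2 * real k * (real k + 1)) * ln (real n)))
      \<le> ereal_of_enat (gr_mixing_time n k)"
proof -
  define C :: real where "C = ln (368/3 * 256 * exp 164)"
  obtain \<rho> where \<rho>: "\<rho> > 0" and roots: "\<And>n k :: nat. 1 \<le> k \<Longrightarrow> k < n \<Longrightarrow> real k \<le> \<rho> * real n \<Longrightarrow>
    (\<exists>a w :: complex. norm a \<le> 8 / real n \<and> exp w = exp a * cosh a
       \<and> exp (of_nat n * a) * cosh a ^ (n - k) = cosh (of_nat k * a)
       \<and> \<bar>Re w + 2 * pi\<^sup>2 * (real k * (real k + 1)) / real n ^ 3\<bar> \<le> \<delta> * (real k * (real k + 1)) / real n ^ 3)"
    using characteristic_root[OF assms(1)] by blast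
  define n0 where "n0 = nat \<lceil>exp (2 * C / \<delta>)\<rceil>"
  show ?thesis
  proof (intro exI[of _ \<rho>] conjI exI[of _ n0] allI impI)
    show "\<rho> > 0" by fact
  next
    fix n k :: nat assume "n0 \<le> n" and k: "1 \<le> k \<and> k < n \<and> real k \<le> \<rho> * real n"
    then have "exp (2 * C / \<delta>) \<le> real n" unfolding n0_def by linarith
    then have "ln (exp (2 * C / \<delta>)) \<le> ln (real n)" using k by (subst ln_le_cancel_iff) auto
    then have big: "C \<le> \<delta> / 2 * ln (real n)" using assms by (simp add: field_simps)
    have lnn: "ln (real n) \<ge> 0" using k by simp
    define kk where "kk = real k * (real k + 1)"
    have kk: "kk > 0" using k by (simp add: kk_def)
    obtain a w :: complex where aw: "norm a \<le> 8 / real n" "exp w = exp a * cosh a"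
       "exp (of_nat n * a) * cosh a ^ (n - k) = cosh (of_nat k * a)"
       "\<bar>Re w + 2 * pi\<^sup>2 * (real k * (real k + 1)) / real n ^ 3\<bar> \<le> \<delta> * (real k * (real k + 1)) / real n ^ 3"
      using roots[of k n] k by blast
    show "ereal ((1 - \<delta>) * (real n ^ 3 / (4 * pi\<^sup>2 * real k * (real k + 1)) * ln (real n)))
      \<le> ereal_of_enat (gr_mixing_time n k)"
      unfolding gr_mixing_time_def
    proof (rule mixing_time_ge[of "[1..<Suc n]"])
      show "[1..<Suc n] \<in> decks n" by (auto simp: decks_mem_iff)
      fix t
      assume "tv_dist (decks n) (chain_law (gr_kernel (pmf_of_set {n - k, n})) [1..<Suc n] t)
        (pmf_of_set (decks n)) \<le> 1/4"
      then have "ln (real n) \<le> C + real t * ((4 * pi\<^sup>2 + 2 * \<delta>) * kk / real n ^ 3)"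
        unfolding C_def kk_def using k assms by (intro tv_close_imp_ln_le[OF _ _ aw]) auto
      with big have "(1 - \<delta> / 2) * ln (real n) \<le> real t * ((4 * pi\<^sup>2 + 2 * \<delta>) * kk / real n ^ 3)"
        by (simp add: algebra_simps)
      also have "\<dots> \<le> real t * ((4 * pi\<^sup>2 * (1 + \<delta> / 2)) * kk / real n ^ 3)"
      proof -
        have "9 \<le> pi\<^sup>2" using power_mono[of 3 pi 2] pi_approx by auto
        then have "2 * \<delta> \<le> 2 * pi\<^sup>2 * \<delta>" using assms by simp
        then have "4 * pi\<^sup>2 + 2 * \<delta> \<le> 4 * pi\<^sup>2 * (1 + \<delta> / 2)" by (simp add: algebra_simps)
        then show ?thesis using kk by (intro mult_left_mono divide_right_mono mult_right_mono) auto
      qed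
      finally have m: "(1 - \<delta> / 2) * ln (real n) \<le> (1 + \<delta> / 2) * (real t * (4 * pi\<^sup>2 * kk / real n ^ 3))"
        by (simp add: mult_ac)
      have "(1 + \<delta> / 2) * ((1 - \<delta>) * ln (real n)) \<le> (1 - \<delta> / 2) * ln (real n)"
      proof -
        have "(1 + \<delta> / 2) * (1 - \<delta>) \<le> 1 - \<delta> / 2" using assms by (simp add: algebra_simps)
        from mult_right_mono[OF this lnn] show ?thesis by (simp only: mult.assoc)
      qed
      also note m
      finally have "(1 - \<delta>) * ln (real n) \<le> real t * (4 * pi\<^sup>2 * kk / real n ^ 3)"
        using assms by (subst (asm) mult_le_cancel_left_pos) auto
      then have "(1 - \<delta>) * ln (real n) * (real n ^ 3 / (4 * pi\<^sup>2 * kk))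
          \<le> real t * (4 * pi\<^sup>2 * kk / real n ^ 3) * (real n ^ 3 / (4 * pi\<^sup>2 * kk))"
        using kk by (intro mult_right_mono) auto
      also have "\<dots> = real t" using kk k by simp
      finally show "(1 - \<delta>) * (real n ^ 3 / (4 * pi\<^sup>2 * real k * (real k + 1)) * ln (real n)) \<le> real t"
        by (simp add: kk_def mult_ac)
    qed
  qed
qed

theorem theorem4p5:
  fixes k :: "nat \<Rightarrow> nat"
  assumes "\<And>n. n \<ge> 2 \<Longrightarrow> 1 \<le> k n \<and> k n \<le> n - 1 \<and> odd (k n)"
    and "(\<lambda>n. real (k n)) \<in> o(\<lambda>n. real n)"
  shows "\<exists>\<epsilon> :: nat \<Rightarrow> real. \<epsilon> \<in> o(\<lambda>_. 1) \<and>
    (\<forall>n\<ge>2. ereal_of_enat (gr_mixing_time n (k n)) \<ge>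
       ereal ((1 + \<epsilon> n) * (real n ^ 3 / (4 * pi\<^sup>2 * real (k n) * (real (k n) + 1)) * ln (real n))))"
proof -
  define B where "B = (\<lambda>n. real n ^ 3 / (4 * pi\<^sup>2 * real (k n) * (real (k n) + 1)) * ln (real n))"
  \<comment> \<open>The largest nonpositive error term for which the bound holds; it remains to see that it vanishes.\<close>
  define \<epsilon> where "\<epsilon> = (\<lambda>n. case gr_mixing_time n (k n) of enat m \<Rightarrow> min 0 (real m / B n - 1) | \<infinity> \<Rightarrow> 0)"
  have B_pos: "B n > 0" if "n \<ge> 2" for n
    using assms(1)[OF that] that unfolding B_def by (intro mult_pos_pos divide_pos_pos) auto
  have "ereal ((1 + \<epsilon> n) * B n) \<le> ereal_of_enat (gr_mixing_time n (k n))" if n: "n \<ge> 2" for n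
  proof (cases "gr_mixing_time n (k n)")
    case (enat m)
    have "(1 + \<epsilon> n) * B n \<le> (real m / B n) * B n"
      using enat B_pos[OF n] by (intro mult_right_mono) (auto simp: \<epsilon>_def)
    then show ?thesis using enat B_pos[OF n] by simp
  qed auto
  moreover have "\<epsilon> \<in> o(\<lambda>_. 1)"
  proof (rule landau_o.smallI)
    fix c :: real assume "c > 0"
    define \<delta> where "\<delta> = min c (1/2)"
    have \<delta>: "0 < \<delta>" "\<delta> < 1" "\<delta> \<le> c" using \<open>c > 0\<close> by (auto simp: \<delta>_def)
    obtain \<rho> n0 where \<rho>: "\<rho> > 0" and bound: "\<And>n k. n \<ge> n0 \<Longrightarrow> 1 \<le> k \<and> k < n \<and> real k \<le> \<rho> * real n \<Longrightarrow>
      ereal ((1 - \<delta>) * (real n ^ 3 / (4 * pi\<^sup>2 * real k * (real k + 1)) * ln (real n)))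
      \<le> ereal_of_enat (gr_mixing_time n k)"
      using gr_mixing_time_lower_bound[OF \<delta>(1,2)] by blast
    have "eventually (\<lambda>n. real (k n) \<le> \<rho> * real n) at_top"
      using landau_o.smallD[OF assms(2) \<rho>] by simp
    then show "eventually (\<lambda>n. norm (\<epsilon> n) \<le> c * norm (1::real)) at_top"
      using eventually_ge_at_top[of n0] eventually_ge_at_top[of 2]
    proof eventually_elim
      case (elim n)
      have "1 \<le> k n \<and> k n < n \<and> real (k n) \<le> \<rho> * real n"
        using assms(1)[of n] elim by auto
      from bound[OF elim(2) this]
      have lb: "ereal ((1 - \<delta>) * B n) \<le> ereal_of_enat (gr_mixing_time n (k n))"
        unfolding B_def .
      have "- \<delta> \<le> \<epsilon> n \<and> \<epsilon> n \<le> 0"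
      proof (cases "gr_mixing_time n (k n)")
        case (enat m)
        then have "1 - \<delta> \<le> real m / B n"
          using lb B_pos[OF elim(3)] by (simp add: field_simps)
        then show ?thesis using enat \<delta> by (auto simp: \<epsilon>_def)
      next
        case infinity
        then show ?thesis using \<delta> by (simp add: \<epsilon>_def)
      qed
      then show ?case using \<delta> by auto
    qed
  qed
  ultimately show ?thesis unfolding B_def by blast
qed

end
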